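(* Let $m,n\ge 1$ be integers, let $p_1,\dots,p_m>0$ with $\sum_{i=1}^m p_i=1$, and let $Y=(Y_1,\dots,Y_n)$ be a vector of i.i.d. random variables with $P(Y_j=i)=p_i$ for all $i\in[m]$ and $j\in[n]$. Let $\mathcal N_n$ be the empirical nerve (random interval graph) of $Y$. Let $0\le k\le m$ and let $p_*=\min\{p_1,\dots,p_m\}$. Then the probability that the graph $\mathcal N_n$ is an empty graph $K_k^c$ on $k$ vertices (exactly $k$ vertices and no edges) satisfies $$P(\mathcal N_n=K_k^c)\ \ge\ p_*^{\,n}\,k!\binom{m}{k}\binom{n-1}{k-1}.$$ Moreover, if $p_i=\frac1m$ for all $i\in[m]$, then $$P(\mathcal N_n=K_k^c)=\frac{k!}{m^n}\binom{m}{k}\binom{n-1}{k-1}.$$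
   Context: Notation: $[N]=\{1,\dots,N\}$. For each label $i\in[m]$, the empirical support is $I_n(i)=\mathrm{Conv}(\{j\in[n]:Y_j=i\})\subset\mathbb R$, i.e. the closed interval from the first to the last index at which label $i$ occurs (possibly a single point; empty if label $i$ does not occur). The empirical nerve $\mathcal N_n$ is the abstract simplicial complex whose simplices are the nonempty subsets $J\subseteq[m]$ with $\bigcap_{i\in J}I_n(i)\ne\emptyset$; its 1-skeleton, denoted by the same symbol, is the graph whose vertices are the labels $i$ with $I_n(i)\neq\emptyset$ and in which $\{i,j\}$, $i\ne j$, is an edge iff $I_n(i)\cap I_n(j)\neq\emptyset$. The event $\mathcal N_n=K_k^c$ means that this graph has exactly $k$ vertices (any $k$ labels) and no edges. Convention: $\binom{a}{b}=0$ if $b<0$ or $b>a$. *)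

theory Defs
  imports "HOL-Probability.Probability"
begin

text \<open>Labels are the natural numbers \<open>{1..m}\<close>; a sample of length \<open>n\<close> is a function
  \<open>y :: nat \<Rightarrow> nat\<close> of which only the values on \<open>{1..n}\<close> matter.\<close>

definition emp_support :: "nat \<Rightarrow> (nat \<Rightarrow> nat) \<Rightarrow> nat \<Rightarrow> real set" where
  "emp_support n y i = convex hull (real ` {j \<in> {1..n}. y j = i})"

definition emp_nerve :: "nat \<Rightarrow> nat \<Rightarrow> (nat \<Rightarrow> nat) \<Rightarrow> nat set set" where
  "emp_nerve m n y = {J. J \<subseteq> {1..m} \<and> J \<noteq> {} \<and> (\<Inter>i\<in>J. emp_support n y i) \<noteq> {}}"

text \<open>A simple graph is a pair of a vertex set and a set of two-element edges. The 1-skeleton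
  of an abstract simplicial complex keeps the simplices of dimension 0 and 1.\<close>

definition one_skeleton :: "'v set set \<Rightarrow> 'v set \<times> 'v set set" where
  "one_skeleton K = ({v. {v} \<in> K}, {e \<in> K. card e = 2})"

definition is_empty_graph :: "nat \<Rightarrow> 'v set \<times> 'v set set \<Rightarrow> bool" where
  "is_empty_graph k G \<longleftrightarrow> finite (fst G) \<and> card (fst G) = k \<and> snd G = {}"

text \<open>Integer arguments, since on naturals \<open>k - 1\<close> is \<open>0\<close> for \<open>k = 0\<close>, which would give
  \<open>(n - 1) choose (k - 1) = 1\<close> where the convention requires \<open>0\<close>.\<close>

definition int_choose :: "int \<Rightarrow> int \<Rightarrow> nat" where
  "int_choose a b = (if b < 0 \<or> b > a then 0 else nat a choose nat b)"

lemma vertices_one_skeleton_emp_nerve: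
  "fst (one_skeleton (emp_nerve m n y)) = {i \<in> {1..m}. emp_support n y i \<noteq> {}}"
  by (auto simp: one_skeleton_def emp_nerve_def)

lemma edges_one_skeleton_emp_nerve:
  "snd (one_skeleton (emp_nerve m n y)) =
     {{i, j} | i j. i \<in> {1..m} \<and> j \<in> {1..m} \<and> i \<noteq> j \<and> emp_support n y i \<inter> emp_support n y j \<noteq> {}}"
  (is "?L = ?R")
proof
  show "?L \<subseteq> ?R"
  proof
    fix e assume e: "e \<in> ?L"
    then obtain i j where ij: "e = {i, j}" "i \<noteq> j"
      by (auto simp: one_skeleton_def card_2_iff)
    with e have "i \<in> {1..m}" "j \<in> {1..m}" "emp_support n y i \<inter> emp_support n y j \<noteq> {}"
      by (auto simp: one_skeleton_def emp_nerve_def)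
    with ij show "e \<in> ?R" by blast
  qed
  show "?R \<subseteq> ?L"
    by (auto simp: one_skeleton_def emp_nerve_def)
qed

end

theory Submission
  imports Defs
begin

text \<open>The nerve has no edges iff every label occupies a contiguous block of the sample. A block
  sequence of length \<open>n + 1\<close> arises from one of length \<open>n\<close> by repeating the last letter or by
  appending a letter not used before, so by Pascal's rule the block sequences with exactly \<open>k\<close>
  letters out of \<open>m\<close> number \<open>k! (m choose k) (n - 1 choose k - 1)\<close>. Each of them has probability
  at least \<open>p\<^sub>*\<^sup>n\<close>, with equality for the uniform distribution.\<close>

section \<open>Membership in the empirical supports\<close>

text \<open>If all of \<open>T\<close> lay strictly to one side of \<open>x\<close>, so would its
  hull, an open half-line being convex. Conversely, the hull is an interval.\<close>

lemma mem_convex_hull_real_iff: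
  fixes T :: "real set"
  shows "x \<in> convex hull T \<longleftrightarrow> (\<exists>s\<in>T. \<exists>t\<in>T. s \<le> x \<and> x \<le> t)"
proof
  assume x: "x \<in> convex hull T"
  have "\<exists>s\<in>T. s \<le> x"
  proof (rule ccontr)
    assume "\<not> ?thesis"
    then have "convex hull T \<subseteq> {x<..}"
      by (intro hull_minimal) auto
    with x show False by auto
  qed
  moreover have "\<exists>t\<in>T. x \<le> t"
  proof (rule ccontr)
    assume "\<not> ?thesis"
    then have "convex hull T \<subseteq> {..<x}"
      by (intro hull_minimal) auto
    with x show False by auto
  qed
  ultimately show "\<exists>s\<in>T. \<exists>t\<in>T. s \<le> x \<and> x \<le> t" by blast
next
  assume "\<exists>s\<in>T. \<exists>t\<in>T. s \<le> x \<and> x \<le> t"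
  then obtain s t where st: "s \<in> T" "t \<in> T" "s \<le> x" "x \<le> t" by blast
  then have "s \<in> convex hull T" "t \<in> convex hull T"
    by (auto intro: hull_inc)
  moreover have "is_interval (convex hull T)"
    by (simp add: is_interval_convex_1)
  ultimately show "x \<in> convex hull T"
    using st(3,4) by (meson is_interval_1)
qed

lemma mem_emp_support_iff:
  "x \<in> emp_support n y a \<longleftrightarrow>
     (\<exists>i\<in>{1..n}. \<exists>l\<in>{1..n}. y i = a \<and> y l = a \<and> real i \<le> x \<and> x \<le> real l)"
  unfolding emp_support_def mem_convex_hull_real_iff by blast

section \<open>Edgeless nerves and contiguous samples\<close>

definition contiguous :: "nat \<Rightarrow> (nat \<Rightarrow> 'b) \<Rightarrow> bool" where
  "contiguous n y \<longleftrightarrow> (\<forall>i j l. 1 \<le> i \<and> i < j \<and> j < l \<and> l \<le> n \<and> y i = y l \<longrightarrow> y j = y i)"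

lemma contiguousD:
  "\<lbrakk>contiguous n y; 1 \<le> i; i \<le> j; j \<le> l; l \<le> n; y i = y l\<rbrakk> \<Longrightarrow> y j = y i"
  unfolding contiguous_def by (metis le_neq_implies_less)

lemma contiguous_cong:
  assumes "\<And>j. j \<in> {1..n} \<Longrightarrow> y j = z j"
  shows "contiguous n y \<longleftrightarrow> contiguous n z"
proof -
  have "contiguous n z" if "contiguous n y" "\<And>j. j \<in> {1..n} \<Longrightarrow> y j = z j" for y z :: "nat \<Rightarrow> 'a"
    unfolding contiguous_def
  proof (intro allI impI, elim conjE)
    fix i j l assume *: "1 \<le> i" "i < j" "j < l" "l \<le> n" "z i = z l"
    have "y i = z i" "y j = z j" "y l = z l"
      using *(1-4) by (intro that(2); simp)+
    with * show "z j = z i"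
      using contiguousD[OF that(1), of i j l] by simp
  qed
  then show ?thesis using assms by metis
qed

text \<open>A foreign label between two occurrences of a label makes two supports meet at its index;
  conversely, meeting supports of distinct labels force such an interleaving. The vertices are the
  labels that occur.\<close>

lemma is_empty_graph_emp_nerve_iff:
  assumes y: "\<And>j. j \<in> {1..n} \<Longrightarrow> y j \<in> {1..m}"
  shows "is_empty_graph k (one_skeleton (emp_nerve m n y)) \<longleftrightarrow>
           contiguous n y \<and> card (y ` {1..n}) = k"
proof -
  have "{i \<in> {1..m}. emp_support n y i \<noteq> {}} = y ` {1..n}"
    using y by (auto simp: emp_support_def)
  then have V: "fst (one_skeleton (emp_nerve m n y)) = y ` {1..n}"
    by (simp add: vertices_one_skeleton_emp_nerve)
  have "snd (one_skeleton (emp_nerve m n y)) = {} \<longleftrightarrow> contiguous n y"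
  proof
    assume E: "snd (one_skeleton (emp_nerve m n y)) = {}"
    show "contiguous n y"
      unfolding contiguous_def
    proof (intro allI impI, elim conjE, rule ccontr)
      fix i j l assume *: "1 \<le> i" "i < j" "j < l" "l \<le> n" "y i = y l" "y j \<noteq> y i"
      have "real j \<in> emp_support n y (y i)"
        unfolding mem_emp_support_iff using *
        by (intro bexI[of _ i] bexI[of _ l]) auto
      moreover have "real j \<in> emp_support n y (y j)"
        unfolding mem_emp_support_iff using *
        by (intro bexI[of _ j]) auto
      moreover have "y i \<in> {1..m}" "y j \<in> {1..m}"
        using * by (intro y; simp)+
      ultimately have "{y i, y j} \<in> snd (one_skeleton (emp_nerve m n y))"
        unfolding edges_one_skeleton_emp_nerve using *(6) by blast
      with E show False by simp
    qed
  next
    assume C: "contiguous n y"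
    have "a = b" if "x \<in> emp_support n y a" "x \<in> emp_support n y b" for a b x
    proof -
      from that(1) obtain i i' where
        i: "i \<in> {1..n}" "i' \<in> {1..n}" "y i = a" "y i' = a" "real i \<le> x" "x \<le> real i'"
        unfolding mem_emp_support_iff by blast
      from that(2) obtain j j' where
        j: "j \<in> {1..n}" "j' \<in> {1..n}" "y j = b" "y j' = b" "real j \<le> x" "x \<le> real j'"
        unfolding mem_emp_support_iff by blast
      \<comment> \<open>Comparison through \<open>x\<close>: the larger of \<open>i\<close> and
        \<open>j\<close> lies between two occurrences of the other label.\<close>
      have "i \<le> j'" "j \<le> i'" using i j by linarith+
      then show ?thesis
        using contiguousD[OF C, of i j i'] contiguousD[OF C, of j i j'] i j
        by (cases "i \<le> j") auto
    qed
    then show "snd (one_skeleton (emp_nerve m n y)) = {}"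
      unfolding edges_one_skeleton_emp_nerve by blast
  qed
  with V show ?thesis
    by (auto simp: is_empty_graph_def)
qed

section \<open>Recursion for block sequences\<close>

text \<open>The functions are extensional, so that each sequence of length \<open>n\<close> is
  represented once and a finite \<open>S\<close> gives a finite set.\<close>

definition block_seqs :: "'b set \<Rightarrow> nat \<Rightarrow> nat \<Rightarrow> (nat \<Rightarrow> 'b) set" where
  "block_seqs S n k =
     {f \<in> {1..n} \<rightarrow>\<^sub>E S. contiguous n f \<and> card (f ` {1..n}) = k}"

lemma finite_block_seqs: "finite S \<Longrightarrow> finite (block_seqs S n k)"
  unfolding block_seqs_def by (intro finite_Collect_conjI disjI1) (simp add: finite_PiE)

lemma block_seqs_0: "n \<ge> 1 \<Longrightarrow> block_seqs S n 0 = {}"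
  by (auto simp: block_seqs_def)

text \<open>If the letter at \<open>Suc n\<close> occurred at \<open>i\<close>, position
  \<open>n\<close> lies between the two and carries it too. Conversely, a triple ending at
  \<open>Suc n\<close> has a last letter that is not new, hence equal to \<open>f n\<close>, so the
  triple may end at \<open>n\<close> instead.\<close>

lemma contiguous_Suc_iff:
  assumes "n \<ge> 1"
  shows "contiguous (Suc n) f \<longleftrightarrow>
    contiguous n f \<and> (f (Suc n) = f n \<or> f (Suc n) \<notin> f ` {1..n})"
proof
  assume C: "contiguous (Suc n) f"
  then have "contiguous n f"
    unfolding contiguous_def by (meson le_SucI)
  moreover have "f (Suc n) = f n" if "f (Suc n) \<in> f ` {1..n}"
  proof -
    from that obtain i where "i \<in> {1..n}" "f (Suc n) = f i" by blast
    then show ?thesis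
      using contiguousD[OF C, of i n "Suc n"] by auto
  qed
  ultimately show "contiguous n f \<and> (f (Suc n) = f n \<or> f (Suc n) \<notin> f ` {1..n})"
    by blast
next
  assume R: "contiguous n f \<and> (f (Suc n) = f n \<or> f (Suc n) \<notin> f ` {1..n})"
  show "contiguous (Suc n) f"
    unfolding contiguous_def
  proof (intro allI impI, elim conjE)
    fix i j l assume *: "1 \<le> i" "i < j" "j < l" "l \<le> Suc n" "f i = f l"
    show "f j = f i"
    proof (cases "l = Suc n")
      case True
      with * have "f (Suc n) \<in> f ` {1..n}" by (intro image_eqI[of _ _ i]) auto
      with R True * show ?thesis
        using contiguousD[of n f i j n] by auto
    next
      case False
      with R * show ?thesis
        using contiguousD[of n f i j l] by auto
    qed
  qed
qed

lemma image_fun_upd_Suc: "(f(Suc n := a)) ` {1..n} = f ` {1..n}"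
  by (intro image_cong) auto

lemma contiguous_fun_upd_Suc: "contiguous n (f(Suc n := a)) \<longleftrightarrow> contiguous n f"
  by (rule contiguous_cong) auto

text \<open>Deleting the last letter inverts both extensions: an old last letter leaves
  \<open>Suc k\<close> letters, a new one leaves \<open>k\<close>.\<close>

lemma block_seqs_Suc:
  assumes n: "n \<ge> 1"
  shows "block_seqs S (Suc n) (Suc k) =
     (\<lambda>f. f(Suc n := f n)) ` block_seqs S n (Suc k) \<union>
     (\<lambda>(f, a). f(Suc n := a)) ` (SIGMA f:block_seqs S n k. S - f ` {1..n})"
    (is "?L = ?A \<union> ?B")
proof
  have atLeastAtMost_Suc: "{1..Suc n} = insert (Suc n) {1..n}"
    by auto
  show "?L \<subseteq> ?A \<union> ?B"
  proof
    fix g assume g: "g \<in> ?L"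
    \<comment> \<open>Resetting the last position to \<open>undefined\<close> makes the truncation
      extensional on \<open>{1..n}\<close>.\<close>
    define f where "f = g(Suc n := undefined)"
    have gf: "g = f(Suc n := g (Suc n))"
      by (simp add: f_def)
    have im: "f ` {1..n} = g ` {1..n}" and fn: "f n = g n"
      and con: "contiguous n f \<longleftrightarrow> contiguous n g"
      unfolding f_def by (simp_all only: image_fun_upd_Suc contiguous_fun_upd_Suc) simp
    have f: "f \<in> {1..n} \<rightarrow>\<^sub>E S"
      using g by (auto simp: block_seqs_def f_def PiE_def Pi_def extensional_def)
    have S: "g (Suc n) \<in> S" using g by (auto simp: block_seqs_def)
    have C: "contiguous n g" "g (Suc n) = g n \<or> g (Suc n) \<notin> g ` {1..n}"
      using g contiguous_Suc_iff[OF n, of g] by (auto simp: block_seqs_def)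
    have card: "card (insert (g (Suc n)) (g ` {1..n})) = Suc k"
      using g unfolding block_seqs_def atLeastAtMost_Suc image_insert by blast
    show "g \<in> ?A \<union> ?B"
    proof (cases "g (Suc n) \<in> g ` {1..n}")
      case True
      with C have "g (Suc n) = f n" by (simp add: fn)
      moreover have "f \<in> block_seqs S n (Suc k)"
        using f C(1) card True im con by (simp add: block_seqs_def insert_absorb)
      ultimately have "g \<in> ?A" using gf by (intro image_eqI[of _ _ f]) simp_all
      then show ?thesis ..
    next
      case False
      then have "f \<in> block_seqs S n k"
        using f C(1) card im con by (simp add: block_seqs_def)
      with False S have "(f, g (Suc n)) \<in> (SIGMA f:block_seqs S n k. S - f ` {1..n})"
        unfolding im[symmetric] by blast
      then have "g \<in> ?B" using gf by (intro image_eqI[of _ _ "(f, g (Suc n))"]) simp_all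
      then show ?thesis ..
    qed
  qed
  \<comment> \<open>Shared by both extensions, which differ only in whether \<open>insert a\<close>
    enlarges the set of letters.\<close>
  have upd: "f(Suc n := a) \<in> ?L"
    if "f \<in> {1..n} \<rightarrow>\<^sub>E S" "contiguous n f" "a \<in> S" "a = f n \<or> a \<notin> f ` {1..n}"
      "card (insert a (f ` {1..n})) = Suc k" for f a
  proof -
    have "f(Suc n := a) \<in> {1..Suc n} \<rightarrow>\<^sub>E S"
      using that(1,3) by (auto simp: PiE_def Pi_def extensional_def)
    moreover have "contiguous (Suc n) (f(Suc n := a))"
      unfolding contiguous_Suc_iff[OF n] image_fun_upd_Suc contiguous_fun_upd_Suc
      using that by simp
    moreover have "(f(Suc n := a)) ` {1..Suc n} = insert a (f ` {1..n})"
      unfolding atLeastAtMost_Suc image_insert image_fun_upd_Suc by simp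
    ultimately show ?thesis
      using that(5) by (simp add: block_seqs_def)
  qed
  show "?A \<union> ?B \<subseteq> ?L"
  proof
    fix g assume "g \<in> ?A \<union> ?B"
    then show "g \<in> ?L"
    proof
      assume "g \<in> ?A"
      then obtain f where f: "f \<in> block_seqs S n (Suc k)" "g = f(Suc n := f n)" by blast
      have "f n \<in> f ` {1..n}" using n by auto
      with f n show ?thesis
        unfolding f(2) by (intro upd) (auto simp: block_seqs_def insert_absorb)
    next
      assume "g \<in> ?B"
      then obtain f a where f: "f \<in> block_seqs S n k" "a \<in> S" "a \<notin> f ` {1..n}"
          "g = f(Suc n := a)"
        by auto
      then show ?thesis
        unfolding f(4) by (intro upd) (auto simp: block_seqs_def)
    qed
  qed
qed

text \<open>The update destroys no information: outside \<open>A\<close> an extensional function is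
  \<open>undefined\<close>, so its value at \<open>x\<close> is known beforehand.\<close>

lemma inj_on_fun_upd_extensional:
  assumes "x \<notin> A"
  shows "inj_on (\<lambda>(f, a). f(x := a)) (extensional A \<times> UNIV)"
proof (rule inj_onI, clarsimp)
  fix f g :: "'a \<Rightarrow> 'b" and a b
  assume *: "f \<in> extensional A" "g \<in> extensional A" "f(x := a) = g(x := b)"
  have "f y = g y" for y
    using fun_cong[OF *(3), of y] *(1,2) assms by (cases "y = x") (auto simp: extensional_def)
  with fun_cong[OF *(3), of x] show "f = g \<and> a = b" by auto
qed

text \<open>Both kinds of extension become sets of pairs under one injective update, so they are
  counted by adding; a sequence with \<open>k\<close> letters leaves \<open>card S - k\<close> new
  ones.\<close>

lemma card_block_seqs_Suc:
  assumes n: "n \<ge> 1" and S: "finite S"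
  shows "card (block_seqs S (Suc n) (Suc k)) =
    card (block_seqs S n (Suc k)) + card (block_seqs S n k) * (card S - k)"
proof -
  let ?u = "\<lambda>(f, a). f(Suc n := a)"
  let ?A = "(\<lambda>f. (f, f n)) ` block_seqs S n (Suc k)"
  let ?B = "SIGMA f:block_seqs S n k. S - f ` {1..n}"
  have fin: "finite ?A" "finite ?B"
    using S by (auto intro!: finite_block_seqs finite_SigmaI)
  have "block_seqs S (Suc n) (Suc k) = ?u ` (?A \<union> ?B)"
    unfolding block_seqs_Suc[OF n] image_Un image_image by simp
  also have "card \<dots> = card (?A \<union> ?B)"
  proof (rule card_image, rule inj_on_subset[OF inj_on_fun_upd_extensional])
    show "?A \<union> ?B \<subseteq> extensional {1..n} \<times> UNIV"
      by (auto simp: block_seqs_def PiE_def)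
  qed simp
  \<comment> \<open>The sets are disjoint because \<open>f n\<close> is an old letter, as
    \<open>n \<ge> 1\<close>, while \<open>?B\<close> pairs \<open>f\<close> with new ones.\<close>
  also have "\<dots> = card ?A + card ?B"
    using fin n by (intro card_Un_disjoint) auto
  also have "card ?A = card (block_seqs S n (Suc k))"
    by (intro card_image inj_onI) simp
  also have "card ?B = (\<Sum>f\<in>block_seqs S n k. card (S - f ` {1..n}))"
    using S by (simp add: finite_block_seqs)
  also have "\<dots> = (\<Sum>f\<in>block_seqs S n k. card S - k)"
  proof (rule sum.cong)
    fix f assume "f \<in> block_seqs S n k"
    then have "f ` {1..n} \<subseteq> S" "card (f ` {1..n}) = k"
      by (auto simp: block_seqs_def)
    then show "card (S - f ` {1..n}) = card S - k"
      by (simp add: card_Diff_subset)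
  qed simp
  finally show ?thesis by simp
qed

section \<open>Closed form of the count\<close>

lemma card_block_seqs_1:
  "card (block_seqs S 1 (Suc k)) = (if k = 0 then card S else 0)"
proof -
  have "contiguous 1 f" for f :: "nat \<Rightarrow> 'a"
    by (auto simp: contiguous_def)
  then have "block_seqs S 1 (Suc k) = (if k = 0 then {1} \<rightarrow>\<^sub>E S else {})"
    by (auto simp: block_seqs_def)
  then show ?thesis by (simp add: card_PiE)
qed

text \<open>The number \<open>fact k * (m choose k)\<close> is the falling factorial of
  \<open>m\<close> with \<open>k\<close> factors, and the next factor is \<open>m - k\<close>. For
  \<open>k \<ge> m\<close> both sides vanish.\<close>

lemma fact_binomial_Suc:
  "fact (Suc k) * (m choose Suc k) = fact k * (m choose k) * (m - k)"
proof -
  have "Suc k * (m choose Suc k) = (m choose k) * (m - k)"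
    by (metis binomial_absorb_comp binomial_absorption mult.commute)
  then show ?thesis by (simp only: fact_Suc mult.assoc of_nat_id mult.left_commute[of "Suc k"])
qed

text \<open>Length and number of letters are shifted by one, so \<open>n choose k\<close> is the
  binomial of their predecessors without truncated subtraction. The recursion lowers the number of
  letters, hence \<open>k\<close> is arbitrary in the induction.\<close>

lemma card_block_seqs:
  assumes "finite S"
  shows "card (block_seqs S (Suc n) (Suc k)) =
    fact (Suc k) * (card S choose Suc k) * (n choose k)"
proof (induction n arbitrary: k)
  case 0
  then show ?case
    using card_block_seqs_1[of S k] by (cases k) simp_all
next
  case (Suc n)
  note rec = card_block_seqs_Suc[OF _ assms, of "Suc n" k]
  show ?case
  proof (cases k)
    case 0
    then show ?thesis using rec Suc.IH[of 0] by (simp add: block_seqs_0)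
  next
    case (Suc l)
    \<comment> \<open>The count with a new last letter, brought to the prefactor of the other
      summand; Pascal's rule then adds \<open>n choose l\<close> and
      \<open>n choose k\<close>.\<close>
    have "fact (Suc k) * (card S choose Suc k) * (n choose l) =
        card (block_seqs S (Suc n) k) * (card S - k)"
      unfolding fact_binomial_Suc[of k] unfolding Suc Suc.IH by (simp only: mult_ac)
    then show ?thesis
      using rec Suc.IH[of k] by (simp add: Suc distrib_left)
  qed
qed

text \<open>For \<open>k = 0\<close> both sides vanish: a nonempty sequence has a letter, and the
  lower index is \<open>-1\<close>. Otherwise the integer differences agree with the shifted natural
  indices.\<close>

lemma card_block_seqs_int_choose:
  assumes "finite S" "n \<ge> 1"
  shows "card (block_seqs S n k) =
    fact k * (card S choose k) * int_choose (int n - 1) (int k - 1)"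
proof (cases k)
  case 0
  with assms show ?thesis by (simp add: block_seqs_0 int_choose_def)
next
  case (Suc l)
  obtain n' where "n = Suc n'" using assms(2) by (cases n) auto
  with Suc card_block_seqs[OF assms(1), of n' l] show ?thesis
    by (simp add: int_choose_def)
qed

section \<open>Events determined by finitely many independent discrete variables\<close>

text \<open>The event is the disjoint union, over the patterns \<open>f\<close> satisfying
  \<open>Q\<close>, of the events that \<open>Y j\<close> equals \<open>f j\<close> for all
  \<open>j\<close> in \<open>I\<close>; independence turns the probability of each into a product.
  The congruence assumption on \<open>Q\<close> lets a sample be replaced by its extensional
  restriction to \<open>I\<close>.\<close>

lemma (in prob_space) prob_indep_discrete:
  assumes indep: "indep_vars (\<lambda>_. count_space S) Y I" and I: "finite I" "I \<noteq> {}"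
    and law: "\<And>i j. i \<in> S \<Longrightarrow> j \<in> I \<Longrightarrow> prob {\<omega> \<in> space M. Y j \<omega> = i} = p i"
    and S: "finite S"
    and Q: "\<And>f g. (\<And>j. j \<in> I \<Longrightarrow> f j = g j) \<Longrightarrow> Q f = Q g"
  shows "prob {\<omega> \<in> space M. Q (\<lambda>j. Y j \<omega>)} = (\<Sum>f\<in>{f \<in> I \<rightarrow>\<^sub>E S. Q f}. \<Prod>j\<in>I. p (f j))"
proof -
  let ?F = "{f \<in> I \<rightarrow>\<^sub>E S. Q f}"
  let ?E = "\<lambda>f. (\<Inter>j\<in>I. Y j -` {f j} \<inter> space M)"
  have meas: "Y j \<in> measurable M (count_space S)" if "j \<in> I" for j
    using indep that by (auto simp: indep_vars_def2)
  have "{\<omega> \<in> space M. Q (\<lambda>j. Y j \<omega>)} = (\<Union>f\<in>?F. ?E f)"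
  proof (intro set_eqI iffI)
    fix \<omega> assume \<omega>: "\<omega> \<in> {\<omega> \<in> space M. Q (\<lambda>j. Y j \<omega>)}"
    let ?f = "restrict (\<lambda>j. Y j \<omega>) I"
    have "Q ?f = Q (\<lambda>j. Y j \<omega>)" by (rule Q) simp
    \<comment> \<open>Measurability into \<open>count_space S\<close> already confines the values to
      \<open>S\<close>.\<close>
    moreover have "Y j \<omega> \<in> S" if "j \<in> I" for j
      using measurable_space[OF meas[OF that]] \<omega> by simp
    ultimately have "?f \<in> ?F" using \<omega> by simp
    moreover have "\<omega> \<in> ?E ?f" using \<omega> by simp
    ultimately show "\<omega> \<in> (\<Union>f\<in>?F. ?E f)" by blast
  next
    fix \<omega> assume "\<omega> \<in> (\<Union>f\<in>?F. ?E f)"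
    then obtain f where f: "f \<in> ?F" "\<omega> \<in> ?E f" by blast
    then have "Q (\<lambda>j. Y j \<omega>) = Q f" by (intro Q) blast
    \<comment> \<open>Since \<open>I\<close> is nonempty, membership in \<open>?E f\<close> includes
      membership in \<open>space M\<close>.\<close>
    with f I show "\<omega> \<in> {\<omega> \<in> space M. Q (\<lambda>j. Y j \<omega>)}" by auto
  qed
  also have "prob \<dots> = (\<Sum>f\<in>?F. prob (?E f))"
  proof (rule finite_measure_finite_Union)
    show "finite ?F"
      using I S by (intro finite_Collect_conjI disjI1) (simp add: finite_PiE)
    show "?E ` ?F \<subseteq> events"
    proof (intro image_subsetI sets.finite_INT I)
      fix f j assume "f \<in> ?F" "j \<in> I"
      then show "Y j -` {f j} \<inter> space M \<in> events"
        by (intro measurable_sets[OF meas]) auto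
    qed
    show "disjoint_family_on ?E ?F"
      unfolding disjoint_family_on_def
    proof (intro ballI impI, rule ccontr)
      fix f g assume *: "f \<in> ?F" "g \<in> ?F" "f \<noteq> g" "?E f \<inter> ?E g \<noteq> {}"
      from *(4) obtain \<omega> where \<omega>: "\<omega> \<in> ?E f" "\<omega> \<in> ?E g"
        unfolding ex_in_conv[symmetric] Int_iff by (elim exE conjE)
      have "f j = g j" if "j \<in> I" for j
        using INT_D[OF \<omega>(1) that] INT_D[OF \<omega>(2) that] by simp
      moreover have "f \<in> I \<rightarrow>\<^sub>E S" "g \<in> I \<rightarrow>\<^sub>E S"
        using *(1,2) by blast+
      ultimately have "f = g" by (intro PiE_ext)
      with *(3) show False by contradiction
    qed
  qed
  also have "\<dots> = (\<Sum>f\<in>?F. \<Prod>j\<in>I. p (f j))"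
  proof (rule sum.cong)
    fix f assume f: "f \<in> ?F"
    have "prob (?E f) = (\<Prod>j\<in>I. prob (Y j -` {f j} \<inter> space M))"
      using f by (intro indep_varsD_finite[OF indep I(2,1)]) auto
    also have "\<dots> = (\<Prod>j\<in>I. p (f j))"
    proof (rule prod.cong)
      fix j assume j: "j \<in> I"
      have "Y j -` {f j} \<inter> space M = {\<omega> \<in> space M. Y j \<omega> = f j}" by auto
      then show "prob (Y j -` {f j} \<inter> space M) = p (f j)"
        using law[of "f j" j] f j by auto
    qed simp
    finally show "prob (?E f) = (\<Prod>j\<in>I. p (f j))" .
  qed simp
  finally show ?thesis .
qed


section \<open>Lower bound and uniform case for the probability of an edgeless nerve\<close>

theorem proposition6:
  fixes M :: "'a measure" and Y :: "nat \<Rightarrow> 'a \<Rightarrow> nat"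
    and p :: "nat \<Rightarrow> real" and m n k :: nat
  assumes "m \<ge> 1" and "n \<ge> 1"
    and "\<And>i. i \<in> {1..m} \<Longrightarrow> p i > 0" and "(\<Sum>i\<in>{1..m}. p i) = 1"
    and "prob_space M"
    and "prob_space.indep_vars M (\<lambda>_. count_space {1..m}) Y {1..n}"
    and "\<And>i j. i \<in> {1..m} \<Longrightarrow> j \<in> {1..n} \<Longrightarrow> \<P>(\<omega> in M. Y j \<omega> = i) = p i"
    and "k \<le> m"
  shows "\<P>(\<omega> in M. is_empty_graph k (one_skeleton (emp_nerve m n (\<lambda>j. Y j \<omega>))))
           \<ge> (Min (p ` {1..m})) ^ n * fact k * real (m choose k)
               * real (int_choose (int n - 1) (int k - 1))
       \<and> ((\<forall>i\<in>{1..m}. p i = 1 / real m) \<longrightarrow>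
            \<P>(\<omega> in M. is_empty_graph k (one_skeleton (emp_nerve m n (\<lambda>j. Y j \<omega>))))
              = fact k / real m ^ n * real (m choose k)
                  * real (int_choose (int n - 1) (int k - 1)))"
proof -
  interpret prob_space M by fact
  let ?N = "card (block_seqs {1..m} n k)"
  let ?P = "prob {\<omega> \<in> space M. is_empty_graph k (one_skeleton (emp_nerve m n (\<lambda>j. Y j \<omega>)))}"
  have N: "real ?N = fact k * real (m choose k) * real (int_choose (int n - 1) (int k - 1))"
    using card_block_seqs_int_choose[of "{1..m}" n k] assms(2) by simp
  have "?P = (\<Sum>f\<in>{f \<in> {1..n} \<rightarrow>\<^sub>E {1..m}. is_empty_graph k (one_skeleton (emp_nerve m n f))}.
      \<Prod>j\<in>{1..n}. p (f j))"
  proof (rule prob_indep_discrete[OF assms(6)])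
    fix f g :: "nat \<Rightarrow> nat" assume "\<And>j. j \<in> {1..n} \<Longrightarrow> f j = g j"
    \<comment> \<open>The nerve depends on the sample only through the index sets within
      \<open>{1..n}\<close>.\<close>
    then have "emp_support n f = emp_support n g"
      unfolding emp_support_def by (intro ext arg_cong[where f = "\<lambda>T. convex hull (real ` T)"]) auto
    then show "is_empty_graph k (one_skeleton (emp_nerve m n f)) =
        is_empty_graph k (one_skeleton (emp_nerve m n g))"
      by (simp add: emp_nerve_def)
  qed (use assms(2,7) in auto)
  also have "{f \<in> {1..n} \<rightarrow>\<^sub>E {1..m}. is_empty_graph k (one_skeleton (emp_nerve m n f))} =
      block_seqs {1..m} n k"
    unfolding block_seqs_def by (intro Collect_cong conj_cong refl is_empty_graph_emp_nerve_iff) auto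
  finally have P: "?P = (\<Sum>f\<in>block_seqs {1..m} n k. \<Prod>j\<in>{1..n}. p (f j))" .
  have vals: "f j \<in> {1..m}" if "f \<in> block_seqs {1..m} n k" "j \<in> {1..n}" for f j
    using that by (auto simp: block_seqs_def)
  have "Min (p ` {1..m}) ^ n * real ?N \<le> ?P"
  proof -
    have "Min (p ` {1..m}) ^ n * real ?N =
        (\<Sum>f\<in>block_seqs {1..m} n k. \<Prod>j\<in>{1..n}. Min (p ` {1..m}))"
      by simp
    also have "\<dots> \<le> ?P"
      unfolding P
    proof (intro sum_mono prod_mono conjI)
      fix f j assume fj: "f \<in> block_seqs {1..m} n k" "j \<in> {1..n}"
      \<comment> \<open>Nonnegativity of the minimum allows the products to be compared factor by
        factor.\<close>
      have "Min (p ` {1..m}) > 0"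
        using assms(1,3) by (subst Min_gr_iff) auto
      then show "0 \<le> Min (p ` {1..m})" by simp
      show "Min (p ` {1..m}) \<le> p (f j)"
        using vals[OF fj] by (intro Min_le) auto
    qed
    finally show ?thesis .
  qed
  moreover have "?P = real ?N / real m ^ n" if unif: "\<forall>i\<in>{1..m}. p i = 1 / real m"
  proof -
    \<comment> \<open>Every block sequence now has the same probability, so only their number
      matters.\<close>
    have "?P = (\<Sum>f\<in>block_seqs {1..m} n k. \<Prod>j\<in>{1..n}. 1 / real m)"
      unfolding P using unif vals by (intro sum.cong prod.cong refl) blast
    then show ?thesis by (simp add: power_divide)
  qed
  ultimately show ?thesis
    unfolding N by (simp add: mult.assoc)
qed

end
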